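(* Let $x>0$ be a real number. Let $n$ be the unique integer such that $2^{-n}\le x<2^{-n+1}$ and put $y=x-2^{-n}$. Then $$F(x)=-F(y)+\sum_{0\le k\le n}2^{\binom{k+1}{2}-\binom{n-k}{2}}\,\frac{d_{n-k}}{(n-k)!}\,\frac{y^k}{k!},$$ where the sum is $0$ when $n<0$.
   Context: The Rvachev function $\operatorname{up}:\mathbb{R}\to\mathbb{R}$ is the infinitely differentiable function with compact support $[-1,1]$ satisfying $\operatorname{up}(0)=1$ and $\operatorname{up}'(x)=2\bigl(\operatorname{up}(2x+1)-\operatorname{up}(2x-1)\bigr)$ for all $x\in\mathbb{R}$; equivalently $\operatorname{up}(x)=\int_{\mathbb{R}}\widehat{\operatorname{up}}(t)e^{2\pi i t x}\,dt$ with $\widehat{\operatorname{up}}(z)=\prod_{n=0}^\infty \frac{\sin(\pi z/2^n)}{\pi z/2^n}$. The Fabius function is $F(x)=\sum_{n=0}^\infty(-1)^{w(n)}\operatorname{up}(x-2n-1)$ for $x\in\mathbb{R}$, where $w(n)$ is the sum of the binary digits of $n$. In particular $F(x)=0$ for $x<0$ and $F'(x)=2F(2x)$ for all $x\in\mathbb{R}$. The rational numbers $d_n$ ($n\ge0$) are the coefficients of the power series $f(x)=\sum_{n\ge0}\frac{d_n}{n!}x^n$ with $f(0)=1$ and $f(2x)=\frac{e^x-1}{x}f(x)$; equivalently they are defined by the recurrence $d_0=1$ and $(n+1)(2^n-1)d_n=\sum_{k=0}^{n-1}\binom{n+1}{k}d_k$ for $n\ge1$. *)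

theory Defs
  imports "HOL-Analysis.Analysis"
begin

definition is_rvachev :: "(real \<Rightarrow> real) \<Rightarrow> bool" where
  "is_rvachev u \<longleftrightarrow>
     (\<forall>k x. (deriv ^^ k) u differentiable (at x)) \<and>
     closure {x. u x \<noteq> 0} = {-1..1} \<and>
     u 0 = 1 \<and>
     (\<forall>x. (u has_real_derivative 2 * (u (2 * x + 1) - u (2 * x - 1))) (at x))"

(* The conditions determine u uniquely: integrating the differential equation gives integral 1,
   and a difference of two solutions would have integral 0 and hence vanish. *)
definition rvachev_up :: "real \<Rightarrow> real" where
  "rvachev_up = (THE u. is_rvachev u)"

(* Since n < 2 ^ n, the binary digits of n in positions k >= n all vanish. *)
definition binary_digit_sum :: "nat \<Rightarrow> nat" where
  "binary_digit_sum n = (\<Sum>k<n. n div 2 ^ k mod 2)"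

(* For every x only finitely many summands are nonzero, so the series converges. *)
definition fabius :: "real \<Rightarrow> real" where
  "fabius x = (\<Sum>n. (-1) ^ binary_digit_sum n * rvachev_up (x - 2 * real n - 1))"

(* The recurrence (n + 1) * (2 ^ n - 1) * d n = (\<Sum>k<n. ((n + 1) choose k) * d k)
   for n >= 1, solved for d n. *)
fun fabius_d :: "nat \<Rightarrow> rat" where
  "fabius_d n =
     (if n = 0 then 1
      else (\<Sum>k<n. of_nat ((n + 1) choose k) * fabius_d k) / (of_nat (n + 1) * (2 ^ n - 1)))"

declare fabius_d.simps [simp del]

lemma fabius_d_0: "fabius_d 0 = 1"
  by (simp add: fabius_d.simps)

lemma fabius_d_rec:
  assumes "n \<ge> 1"
  shows "of_nat (n + 1) * (2 ^ n - 1) * fabius_d n = (\<Sum>k<n. of_nat ((n + 1) choose k) * fabius_d k)"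
proof -
  have "(2 :: rat) ^ n > 1"
    using assms by (intro one_less_power) auto
  hence "of_nat (n + 1) * (2 ^ n - 1 :: rat) \<noteq> 0"
    by (simp del: of_nat_Suc of_nat_add)
  thus ?thesis
    using assms by (subst fabius_d.simps) (simp del: of_nat_Suc of_nat_add)
qed

lemma dyadic_scale_unique:
  fixes x :: real
  assumes "x > 0"
  shows "\<exists>!n::int. 2 powi (-n) \<le> x \<and> x < 2 powi (-n + 1)"
proof -
  have *: "2 powi (-n) \<le> x \<and> x < 2 powi (-n + 1) \<longleftrightarrow> \<lfloor>log 2 x\<rfloor> = -n" for n :: int
  proof -
    have "2 powi m \<le> x \<longleftrightarrow> of_int m \<le> log 2 x" "x < 2 powi m \<longleftrightarrow> log 2 x < of_int m" for m :: int
      using assms by (simp_all add: le_log_iff log_less_iff powr_real_of_int')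
    thus ?thesis
      by (simp add: floor_eq_iff del: of_int_minus of_int_add) (simp add: algebra_simps)
  qed
  show ?thesis
    unfolding * by (intro ex1I[of _ "- \<lfloor>log 2 x\<rfloor>"]) auto
qed

end

theory Submission
  imports Defs
begin

text \<open>
  On [0, 2] the Fabius function satisfies F'(x) = 2 F(2x), F(0) = 0 and F(x + 2) = - F(x). Hence
  G(y) = F(2^(-n) + y) + F(y) has derivative 2 (F(2^(1-n) + 2y) + F(2y)), and induction on n, with
  F(2 + y) + F(y) = 0 at the start, makes G on [0, 2^(-n)] a polynomial whose Taylor coefficients
  are multiples of the values F(2^(k-n)). At y = 2^(-n) this identity is a recurrence for these
  values, equivalent to that of the d_n. For x \<ge> 2 there is only the binary digit sum to compare.

  That a Rvachev function is unique follows from the same formula: for the difference of two of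
  them the polynomial vanishes, so its values propagate unchanged up to sign to points
  arbitrarily close to 0. Existence comes from Banach's fixed point theorem, applied to the map
  that sends f to the function x \<mapsto> \<integral>f over [2x - 1, 2x] on distribution functions
  symmetric about 1/2; if f is the fixed point, up(x) = f(x + 1) - f(x).
\<close>

lemma has_real_derivative_unique_antiderivative:
  fixes f g :: "real \<Rightarrow> real"
  assumes f: "\<And>x. a \<le> x \<Longrightarrow> x \<le> b \<Longrightarrow> (f has_real_derivative h x) (at x)"
    and g: "\<And>x. a \<le> x \<Longrightarrow> x \<le> b \<Longrightarrow> (g has_real_derivative h x) (at x)"
    and "f a = g a" "a \<le> x" "x \<le> b"
  shows "f x = g x"
proof (cases "a = x")
  case False
  hence "a < x" using assms by simp
  moreover have d: "((\<lambda>x. f x - g x) has_real_derivative 0) (at t)" if "a \<le> t" "t \<le> x" for t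
    using DERIV_diff[OF f[of t] g[of t]] that \<open>x \<le> b\<close> by simp
  moreover have "continuous_on {a..x} (\<lambda>x. f x - g x)"
    by (intro continuous_at_imp_continuous_on ballI DERIV_isCont[OF d]) auto
  ultimately have "f x - g x = f a - g a"
    by (intro DERIV_isconst_end) auto
  thus ?thesis using assms by simp
qed (use assms in simp)

section \<open>The functional equation on [0, 2]\<close>

lemma Suc_Suc_choose_2: "Suc (Suc k) choose 2 = (Suc k choose 2) + Suc k"
  by (simp add: numeral_2_eq_2)

text \<open>The value \<open>F 1\<close> is left free: it is 1 in the application to the Fabius
  function and 0 in the one to the difference of two Rvachev functions.\<close>

locale fabius_equation =
  fixes F :: "real \<Rightarrow> real"
  assumes deriv: "\<And>x. 0 \<le> x \<Longrightarrow> x \<le> 2 \<Longrightarrow> (F has_real_derivative 2 * F (2 * x)) (at x)"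
    and zero: "F 0 = 0"
    and antiperiodic: "\<And>x. 0 \<le> x \<Longrightarrow> x \<le> 2 \<Longrightarrow> F (x + 2) = - F x"
begin

text \<open>The k-th derivative of F at x is F(2^k x) times 2^(1 + ... + k), hence the exponent
  \<open>Suc k choose 2\<close>. The summand \<open>F y\<close> adds nothing to the coefficients, as
  all its derivatives at 0 are multiples of \<open>F 0\<close>.\<close>

lemma shift_eq_taylor:
  assumes "0 \<le> y" "y \<le> 1 / 2 ^ n"
  shows "F (1 / 2 ^ n + y) + F y =
    (\<Sum>k\<le>n. 2 ^ (Suc k choose 2) * F (2 ^ k / 2 ^ n) * y ^ k / fact k)"
  using assms
proof (induction n arbitrary: y)
  case 0
  have "F (1 + y) + F y = F 1"
  proof (rule has_real_derivative_unique_antiderivative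
      [where f = "\<lambda>y. F (1 + y) + F y" and g = "\<lambda>_. F 1" and a = 0 and b = 1 and h = "\<lambda>_. 0"])
    fix t :: real assume t: "0 \<le> t" "t \<le> 1"
    have "((\<lambda>y. F (1 + y) + F y) has_real_derivative 2 * F (2 * (1 + t)) * 1 + 2 * F (2 * t)) (at t)"
      using t by (intro derivative_intros DERIV_chain2[OF deriv] deriv) (auto intro!: derivative_eq_intros)
    moreover have "F (2 * (1 + t)) = - F (2 * t)"
      using antiperiodic[of "2 * t"] t by (simp add: algebra_simps)
    ultimately show "((\<lambda>y. F (1 + y) + F y) has_real_derivative 0) (at t)" by simp
  qed (use 0 zero in auto)
  thus ?case by (simp add: numeral_2_eq_2)
next
  case (Suc n)
  let ?P = "\<lambda>y. \<Sum>k\<le>n. 2 ^ (Suc k choose 2) * F (2 ^ k / 2 ^ n) * y ^ k / fact k"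
  let ?Q = "\<lambda>y. F (1 / 2 ^ Suc n) +
    (\<Sum>k\<le>n. 2 ^ (Suc (Suc k) choose 2) * F (2 ^ k / 2 ^ n) * y ^ Suc k / fact (Suc k))"
  have "F (1 / 2 ^ Suc n + y) + F y = ?Q y"
  proof (rule has_real_derivative_unique_antiderivative
      [where f = "\<lambda>y. F (1 / 2 ^ Suc n + y) + F y" and g = ?Q and a = 0 and b = "1 / 2 ^ Suc n" and h = "\<lambda>y. 2 * ?P (2 * y)"])
    fix t :: real assume t: "0 \<le> t" "t \<le> 1 / 2 ^ Suc n"
    have "1 / 2 ^ Suc n \<le> (1 :: real)"
      by (simp add: divide_simps) (metis one_le_numeral one_le_power power_Suc)
    with t have "1 / 2 ^ Suc n + t \<le> 2" "t \<le> 2" by linarith+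
    hence "((\<lambda>y. F (1 / 2 ^ Suc n + y) + F y) has_real_derivative
        2 * F (2 * (1 / 2 ^ Suc n + t)) * 1 + 2 * F (2 * t)) (at t)"
      using t by (intro derivative_intros DERIV_chain2[OF deriv] deriv)
        (auto intro!: derivative_eq_intros simp del: power_Suc)
    moreover have "2 * F (2 * (1 / 2 ^ Suc n + t)) * 1 + 2 * F (2 * t) = 2 * ?P (2 * t)"
      using Suc.IH[of "2 * t"] t by (simp add: algebra_simps)
    ultimately show "((\<lambda>y. F (1 / 2 ^ Suc n + y) + F y) has_real_derivative 2 * ?P (2 * t)) (at t)"
      by simp
  next
    fix t :: real
    have "((\<lambda>y. 2 ^ (Suc (Suc k) choose 2) * F (2 ^ k / 2 ^ n) * y ^ Suc k / fact (Suc k))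
        has_real_derivative
        2 * (2 ^ (Suc k choose 2) * F (2 ^ k / 2 ^ n) * (2 * t) ^ k / fact k)) (at t)" for k
    proof -
      have "((\<lambda>y. 2 ^ (Suc (Suc k) choose 2) * F (2 ^ k / 2 ^ n) * y ^ Suc k / fact (Suc k))
        has_real_derivative
        2 ^ (Suc (Suc k) choose 2) * F (2 ^ k / 2 ^ n) * (of_nat (Suc k) * t ^ k) / fact (Suc k)) (at t)"
        by (auto intro!: derivative_eq_intros simp del: fact_Suc power_Suc of_nat_Suc)
      \<comment> \<open>The exponent grows by \<open>Suc k\<close>: one factor 2 comes from the
        derivative of F, the other k from \<open>(2 * t) ^ k\<close>.\<close>
      also have "2 ^ (Suc (Suc k) choose 2) * F (2 ^ k / 2 ^ n) * (of_nat (Suc k) * t ^ k) / fact (Suc k)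
        = 2 * (2 ^ (Suc k choose 2) * F (2 ^ k / 2 ^ n) * (2 * t) ^ k / fact k)"
        by (simp add: Suc_Suc_choose_2 power_add field_simps
            del: of_nat_Suc binomial_Suc_Suc)
      finally show ?thesis .
    qed
    hence "(?Q has_real_derivative 
       0 + (\<Sum>k\<le>n. 2 * (2 ^ (Suc k choose 2) * F (2 ^ k / 2 ^ n) * (2 * t) ^ k / fact k))) (at t)"
      by (intro DERIV_add DERIV_sum DERIV_const)
    thus "(?Q has_real_derivative 2 * ?P (2 * t)) (at t)"
      by (simp only: sum_distrib_left add_0)
  qed (use Suc.prems zero in auto)
  also have "?Q y = (\<Sum>k\<le>Suc n. 2 ^ (Suc k choose 2) * F (2 ^ k / 2 ^ Suc n) * y ^ k / fact k)"
    by (subst sum.atMost_Suc_shift) (simp del: fact_Suc add: numeral_2_eq_2)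
  finally show ?case .
qed

lemma value_at_inverse_power_2:
  "F (1 / 2 ^ n) = F 1 * of_rat (fabius_d n) / (2 ^ (n choose 2) * fact n)"
proof (induction n rule: less_induct)
  case (less n)
  \<comment> \<open>In this normalisation the Taylor identity becomes the linear recurrence of
    \<open>fabius_d\<close>, with initial value \<open>a 0 = F 1\<close>.\<close>
  define a where "a k = F (1 / 2 ^ k) * 2 ^ (k choose 2) * fact k" for k
  have F_a: "F (1 / 2 ^ k) = a k / (2 ^ (k choose 2) * fact k)" for k
    by (simp add: a_def)
  have "a n = F 1 * of_rat (fabius_d n)"
  proof (cases "n = 0")
    case True
    thus ?thesis by (simp add: a_def fabius_d_0 numeral_2_eq_2)
  next
    case False
    hence n: "n \<ge> 1" by simp
    let ?N = "Suc n"
    \<comment> \<open>Stage n + 1 at its right endpoint. The value at \<open>1 / 2 ^ ?N\<close> is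
      also the summand k = 0 and cancels below, which leaves only \<open>a j\<close> with j \<le>
      n.\<close>
    have "F (1 / 2 ^ n) + F (1 / 2 ^ ?N) =
      (\<Sum>k\<le>?N. 2 ^ (Suc k choose 2) * F (2 ^ k / 2 ^ ?N) * (1 / 2 ^ ?N) ^ k / fact k)"
      using shift_eq_taylor[of "1 / 2 ^ ?N" ?N] by simp
    also have "\<dots> = (\<Sum>j\<le>?N. a j / (2 ^ (?N choose 2) * fact j * fact (?N - j)))"
    proof (subst sum.nat_diff_reindex[symmetric, of _ "Suc ?N", unfolded lessThan_Suc_atMost], rule sum.cong)
      fix j assume "j \<in> {..?N}"
      hence j: "j \<le> ?N" by simp
      then obtain k where k: "?N = j + k" by (metis le_Suc_ex)
      \<comment> \<open>Collects the powers of 2 in a summand: what remains is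
        \<open>2 ^ (?N choose 2)\<close>, the same for every j.\<close>
      have "(Suc k choose 2) + ((j + k) choose 2) = (j choose 2) + (j + k) * k"
        by (induction k) (simp_all add: numeral_2_eq_2)
      hence "2 ^ (Suc k choose 2) * 2 ^ (?N choose 2) = 2 ^ (j choose 2) * ((2 :: real) ^ ?N) ^ k"
        unfolding k power_add[symmetric] power_mult[symmetric] by simp
      moreover have "Suc ?N - Suc j = k" "?N - j = k" using k by auto
      moreover have "F (2 ^ k / 2 ^ ?N) = a j / (2 ^ (j choose 2) * fact j)"
        unfolding F_a[symmetric] k by (simp add: power_add)
      ultimately show "2 ^ (Suc (Suc ?N - Suc j) choose 2) * F (2 ^ (Suc ?N - Suc j) / 2 ^ ?N) *
         (1 / 2 ^ ?N) ^ (Suc ?N - Suc j) / fact (Suc ?N - Suc j) =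
         a j / (2 ^ (?N choose 2) * fact j * fact (?N - j))"
        by (simp add: power_one_over frac_eq_eq mult_ac
            del: binomial_Suc_Suc power_Suc fact_Suc)
    qed simp
    also have "\<dots> = (\<Sum>j<n. a j / (2 ^ (?N choose 2) * fact j * fact (?N - j))) +
       a n / (2 ^ (?N choose 2) * fact n) + F (1 / 2 ^ ?N)"
      by (simp add: F_a lessThan_Suc_atMost[symmetric] del: fact_Suc power_Suc)
    finally have "F (1 / 2 ^ n) = (\<Sum>j<n. a j / (2 ^ (?N choose 2) * fact j * fact (?N - j))) +
       a n / (2 ^ (?N choose 2) * fact n)"
      by simp
    hence "F (1 / 2 ^ n) * (2 ^ (?N choose 2) * fact ?N) =
       ((\<Sum>j<n. a j / (2 ^ (?N choose 2) * fact j * fact (?N - j))) +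
       a n / (2 ^ (?N choose 2) * fact n)) * (2 ^ (?N choose 2) * fact ?N)"
      by (rule arg_cong)
    also have "\<dots> = (\<Sum>j<n. of_nat (?N choose j) * a j) + of_nat ?N * a n"
    proof -
      have "a j / (2 ^ (?N choose 2) * fact j * fact (?N - j)) * (2 ^ (?N choose 2) * fact ?N)
        = of_nat (?N choose j) * a j" if "j < n" for j
        using that by (simp add: binomial_fact field_simps del: fact_Suc binomial_Suc_Suc)
      moreover have "a n / (2 ^ (?N choose 2) * fact n) * (2 ^ (?N choose 2) * fact ?N) = of_nat ?N * a n"
        by (simp add: field_simps)
      ultimately show ?thesis
        by (simp add: distrib_right sum_distrib_right del: fact_Suc binomial_Suc_Suc of_nat_Suc)
    qed
    \<comment> \<open>\<open>?N choose 2\<close> exceeds \<open>n choose 2\<close> by n, whence the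
      factor \<open>2 ^ n\<close>; subtracting the term with \<open>a n\<close> on the other side
      turns it into \<open>2 ^ n - 1\<close>.\<close>
    also have "F (1 / 2 ^ n) * (2 ^ (?N choose 2) * fact ?N) = of_nat ?N * 2 ^ n * a n"
      by (simp add: a_def power_add numeral_2_eq_2 mult_ac)
    finally have "of_nat ?N * (2 ^ n - 1) * a n = (\<Sum>j<n. of_nat (?N choose j) * a j)"
      by (simp add: algebra_simps del: binomial_Suc_Suc of_nat_Suc)
    also have "\<dots> = (\<Sum>j<n. of_nat (?N choose j) * (F 1 * of_rat (fabius_d j)))"
      by (intro sum.cong refl) (simp add: a_def less del: binomial_Suc_Suc)
    also have "\<dots> = F 1 * of_rat (\<Sum>j<n. of_nat ((n + 1) choose j) * fabius_d j)"
      by (simp add: of_rat_sum of_rat_mult sum_distrib_left mult_ac del: binomial_Suc_Suc)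
    also have "\<dots> = of_nat ?N * (2 ^ n - 1) * (F 1 * of_rat (fabius_d n))"
      unfolding fabius_d_rec[OF n, symmetric]
      by (simp add: of_rat_mult of_rat_diff of_rat_power of_rat_add mult_ac)
    finally have "of_nat ?N * (2 ^ n - 1) * a n = of_nat ?N * (2 ^ n - 1) * (F 1 * of_rat (fabius_d n))" .
    moreover have "(2 :: real) ^ n > 1" using n by (intro one_less_power) auto
    ultimately show ?thesis by (simp del: of_nat_Suc)
  qed
  thus ?case by (simp add: F_a)
qed

lemma shift_eq_polynomial:
  assumes "0 \<le> y" "y \<le> 1 / 2 ^ n"
  shows "F (1 / 2 ^ n + y) + F y = F 1 *
    (\<Sum>k\<le>n. 2 ^ (Suc k choose 2) / 2 ^ ((n - k) choose 2) *
       (of_rat (fabius_d (n - k)) / fact (n - k)) * (y ^ k / fact k))"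
proof -
  have "F (2 ^ k / 2 ^ n) = F 1 * of_rat (fabius_d (n - k)) / (2 ^ ((n - k) choose 2) * fact (n - k))"
    if "k \<le> n" for k
    using value_at_inverse_power_2[of "n - k"] that by (simp add: power_diff)
  thus ?thesis
    unfolding shift_eq_taylor[OF assms] sum_distrib_left
    by (intro sum.cong) (auto simp: field_simps simp del: binomial_Suc_Suc)
qed

text \<open>With F 1 = 0 the polynomial vanishes, so each value of F recurs up to sign
  at a point at most half as large.\<close>

lemma eq_zero:
  assumes "F 1 = 0" "0 \<le> x" "x \<le> 2"
  shows "F x = 0"
proof -
  have half: "\<exists>y. 0 \<le> y \<and> y \<le> x / 2 \<and> \<bar>F y\<bar> = \<bar>F x\<bar>" if x: "0 \<le> x" "x \<le> 2" for x
  proof (cases "x = 0 \<or> x = 2")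
    case True
    \<comment> \<open>The point 2 needs its own argument, since its dyadic scale is n = -1; there F
      2 = - F 0 = 0.\<close>
    thus ?thesis using zero antiperiodic[of 0] by (intro exI[of _ 0]) auto
  next
    case False
    hence "x > 0" "x < 2" using x by auto
    obtain n :: int where n: "2 powi (-n) \<le> x" "x < 2 powi (-n + 1)"
      using dyadic_scale_unique[OF \<open>x > 0\<close>] by auto
    have "n \<ge> 0"
    proof (rule ccontr)
      assume "\<not> n \<ge> 0"
      hence "(2 :: real) powi 1 \<le> 2 powi (-n)" by (intro power_int_increasing) auto
      thus False using n \<open>x < 2\<close> by simp
    qed
    then obtain m where m: "n = int m" using nonneg_int_cases by blast
    have "1 / 2 ^ m \<le> x" "x < 2 / 2 ^ m"
      using n by (simp_all add: m power_int_add power_int_minus field_simps power_int_diff)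
    hence "F (1 / 2 ^ m + (x - 1 / 2 ^ m)) + F (x - 1 / 2 ^ m) = 0"
      using shift_eq_polynomial[of "x - 1 / 2 ^ m" m] \<open>F 1 = 0\<close> by simp
    hence "F (x - 1 / 2 ^ m) = - F x" by simp
    \<comment> \<open>From x < 2 / 2^m it follows that 1 / 2^m > x / 2, so the shifted point lies
      below x / 2.\<close>
    thus ?thesis using \<open>1 / 2 ^ m \<le> x\<close> \<open>x < 2 / 2 ^ m\<close>
      by (intro exI[of _ "x - 1 / 2 ^ m"]) auto
  qed
  have "\<exists>y. 0 \<le> y \<and> y \<le> x / 2 ^ m \<and> \<bar>F y\<bar> = \<bar>F x\<bar>" for m
  proof (induction m)
    case (Suc m)
    then obtain y where y: "0 \<le> y" "y \<le> x / 2 ^ m" "\<bar>F y\<bar> = \<bar>F x\<bar>" by auto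
    have "x / 2 ^ m \<le> x / 1" using \<open>0 \<le> x\<close> by (intro divide_left_mono) auto
    with half[of y] y \<open>x \<le> 2\<close> obtain z where
      z: "0 \<le> z" "z \<le> y / 2" "\<bar>F z\<bar> = \<bar>F x\<bar>" by auto
    have "z \<le> x / 2 ^ m / 2" by (rule order.trans[OF z(2) divide_right_mono[OF y(2)]]) simp
    hence "z \<le> x / 2 ^ Suc m" by simp
    with z show ?case by blast
  qed (use assms in auto)
  then obtain y where y: "\<And>m. 0 \<le> y m" "\<And>m. y m \<le> x / 2 ^ m" "\<And>m. \<bar>F (y m)\<bar> = \<bar>F x\<bar>"
    by metis
  have "(\<lambda>m. x * (1 / 2) ^ m) \<longlonglongrightarrow> x * 0"
    by (intro tendsto_intros LIMSEQ_realpow_zero) auto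
  hence "y \<longlonglongrightarrow> 0"
    using y by (intro tendsto_sandwich[of "\<lambda>_. 0" y _ "\<lambda>m. x * (1 / 2) ^ m"])
      (auto simp: field_simps)
  moreover have "isCont F 0" using deriv[of 0] by (intro DERIV_isCont) auto
  ultimately have "(\<lambda>m. \<bar>F (y m)\<bar>) \<longlonglongrightarrow> \<bar>F 0\<bar>"
    by (intro tendsto_rabs isCont_tendsto_compose[of 0 F])
  thus ?thesis by (simp add: y zero LIMSEQ_const_iff)
qed

end

text \<open>These are the first two summands of the Fabius series, the only ones that matter on
  [0, 4]. The hypotheses are linear in v, so they hold for differences of Rvachev functions as
  well.\<close>

lemma fabius_equation_of_rvachev_equation:
  fixes v :: "real \<Rightarrow> real"
  assumes vanish: "\<And>x. \<bar>x\<bar> \<ge> 1 \<Longrightarrow> v x = 0"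
    and v: "\<And>x. (v has_real_derivative 2 * (v (2 * x + 1) - v (2 * x - 1))) (at x)"
  shows "fabius_equation (\<lambda>x. v (x - 1) - v (x - 3))"
proof
  fix x :: real assume x: "0 \<le> x" "x \<le> 2"
  have "((\<lambda>x. v (x - 1) - v (x - 3)) has_real_derivative
     2 * (v (2 * (x - 1) + 1) - v (2 * (x - 1) - 1)) * 1 -
     2 * (v (2 * (x - 3) + 1) - v (2 * (x - 3) - 1)) * 1) (at x)"
    by (intro DERIV_diff DERIV_chain2[OF v]) (auto intro!: derivative_eq_intros)
  moreover have "v (2 * (x - 3) + 1) = 0" "v (2 * (x - 3) - 1) = 0"
    using x by (auto intro!: vanish)
  ultimately show "((\<lambda>x. v (x - 1) - v (x - 3)) has_real_derivative
     2 * (v (2 * x - 1) - v (2 * x - 3))) (at x)"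
    by (simp add: algebra_simps)
next
  fix x :: real assume x: "0 \<le> x" "x \<le> 2"
  have "v (x + 1) = 0" "v (x - 3) = 0" using x by (auto intro!: vanish)
  thus "v (x + 2 - 1) - v (x + 2 - 3) = - (v (x - 1) - v (x - 3))" by (simp add: algebra_simps)
qed (simp add: vanish)

section \<open>Uniqueness of the Rvachev function\<close>

lemma is_rvachev_vanish:
  assumes "is_rvachev u" "\<bar>x\<bar> \<ge> 1"
  shows "u x = 0"
proof -
  have "continuous_on UNIV u"
    using assms(1) by (auto simp: is_rvachev_def intro!: continuous_at_imp_continuous_on DERIV_isCont)
  hence "open {x. u x \<noteq> 0}"
    by (intro open_Collect_neq continuous_on_const)
  moreover have "{x. u x \<noteq> 0} \<subseteq> {-1..1}"
    using assms(1) closure_subset unfolding is_rvachev_def by metis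
  \<comment> \<open>An open subset of [-1, 1] lies in (-1, 1), so u vanishes at the two endpoints
    too.\<close>
  ultimately have "{x. u x \<noteq> 0} \<subseteq> interior {-1..1}" by (rule interior_maximal[rotated])
  thus ?thesis using assms(2) by (auto simp: abs_if split: if_splits)
qed

lemma is_rvachev_unique:
  assumes "is_rvachev u" "is_rvachev v"
  shows "u = v"
proof
  fix x
  interpret fabius_equation "\<lambda>x. (u (x - 1) - v (x - 1)) - (u (x - 3) - v (x - 3))"
  proof (rule fabius_equation_of_rvachev_equation[of "\<lambda>x. u x - v x"])
    fix x
    have "((\<lambda>x. u x - v x) has_real_derivative 2 * (u (2 * x + 1) - u (2 * x - 1)) - 
      2 * (v (2 * x + 1) - v (2 * x - 1))) (at x)"
      using assms by (intro DERIV_diff) (auto simp: is_rvachev_def)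
    thus "((\<lambda>x. u x - v x) has_real_derivative
        2 * (u (2 * x + 1) - v (2 * x + 1) - (u (2 * x - 1) - v (2 * x - 1)))) (at x)"
      by (simp add: algebra_simps)
  qed (simp add: is_rvachev_vanish assms)
  show "u x = v x"
  proof (cases "\<bar>x\<bar> < 1")
    case True
    \<comment> \<open>The second translates vanish at 1 and at x + 1, so there the locale function
      takes the values u 0 - v 0 = 0 and u x - v x.\<close>
    have "u (x - 2) = 0" "v (x - 2) = 0" "u (-2) = 0" "v (-2) = 0"
      using True assms[THEN is_rvachev_vanish] by auto
    moreover have "u 0 = v 0"
      using assms by (simp add: is_rvachev_def)
    ultimately show ?thesis using eq_zero[of "x + 1"] True by (simp add: abs_if split: if_splits)
  qed (simp add: is_rvachev_vanish assms)
qed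

section \<open>Existence of the Rvachev function\<close>

lemma continuous_has_antiderivative:
  fixes f :: "real \<Rightarrow> real"
  assumes "continuous_on UNIV f"
  shows "\<exists>G. \<forall>x. (G has_real_derivative f x) (at x)"
  using einterval_antiderivative[of "-\<infinity>" \<infinity> f] assms
  by (auto simp: continuous_on_eq_continuous_at has_real_derivative_iff_has_vector_derivative)

lemma abs_diff_le_of_deriv_bound:
  fixes H :: "real \<Rightarrow> real"
  assumes "\<And>x. (H has_real_derivative h x) (at x)" "\<And>x. \<bar>h x\<bar> \<le> M"
  shows "\<bar>H a - H b\<bar> \<le> M * \<bar>a - b\<bar>"
  using field_differentiable_bound[of UNIV H h M b a] assms
  by (auto simp: abs_minus_commute)

lemma has_real_derivative_zero_ray:
  fixes H :: "real \<Rightarrow> real"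
  assumes "\<And>x. (H has_real_derivative h x) (at x)" "\<And>x. x \<le> c \<Longrightarrow> h x = 0" "x \<le> c"
  shows "H x = H c"
proof (cases "x = c")
  case False
  have "continuous_on {x..c} H"
    by (intro continuous_at_imp_continuous_on ballI DERIV_isCont[OF assms(1)])
  moreover have "(H has_real_derivative 0) (at t)" if "t < c" for t
    using assms(1)[of t] assms(2)[of t] that by simp
  ultimately show ?thesis using False assms(3) DERIV_isconst_end[of x c H] by simp
qed simp

section \<open>Symmetric distribution functions and the averaging operator\<close>

definition symmetric_cdf :: "(real \<Rightarrow> real) \<Rightarrow> bool" where
  "symmetric_cdf f \<longleftrightarrow> mono f \<and> (\<forall>x\<le>0. f x = 0) \<and> (\<forall>x. f x + f (1 - x) = 1)"

lemma symmetric_cdf_simps: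
  assumes "symmetric_cdf f"
  shows "x \<le> 0 \<Longrightarrow> f x = 0" "x \<ge> 1 \<Longrightarrow> f x = 1" "f (1 - x) = 1 - f x"
    "0 \<le> f x" "f x \<le> 1" "x \<le> y \<Longrightarrow> f x \<le> f y"
proof -
  have le: "x \<le> y \<Longrightarrow> f x \<le> f y" for x y
    using assms by (auto simp: symmetric_cdf_def dest: monoD)
  have sym: "f (1 - x) = 1 - f x" for x
    using assms by (simp add: symmetric_cdf_def algebra_simps)
  have zero: "x \<le> 0 \<Longrightarrow> f x = 0" for x
    using assms by (simp add: symmetric_cdf_def)
  show "x \<le> 0 \<Longrightarrow> f x = 0" "f (1 - x) = 1 - f x" "x \<le> y \<Longrightarrow> f x \<le> f y"
    by (fact zero sym le)+
  show "x \<ge> 1 \<Longrightarrow> f x = 1" using zero[of "1 - x"] sym[of x] by simp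
  have nonneg: "0 \<le> f x" for x using le[of "min x 0" x] zero[of "min x 0"] by simp
  show "0 \<le> f x" by (fact nonneg)
  show "f x \<le> 1" using nonneg[of "1 - x"] sym[of x] by simp
qed

text \<open>The constant of integration is arbitrary, as only differences of values are
  used.\<close>

definition antideriv :: "(real \<Rightarrow> real) \<Rightarrow> real \<Rightarrow> real" where
  "antideriv f = (SOME G. \<forall>x. (G has_real_derivative f x) (at x))"

text \<open>The average over a window of length 1, followed by the dilation by 2: on distribution
  functions this is the passage from X to (X + U) / 2 with U uniform on the unit interval.\<close>

definition window_average :: "(real \<Rightarrow> real) \<Rightarrow> real \<Rightarrow> real" where
  "window_average f x = antideriv f (2 * x) - antideriv f (2 * x - 1)"

lemma antideriv:
  assumes "continuous_on UNIV f"
  shows "(antideriv f has_real_derivative f x) (at x)"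
  using someI_ex[OF continuous_has_antiderivative[OF assms]] unfolding antideriv_def by blast

lemma window_average_deriv:
  assumes "continuous_on UNIV f"
  shows "(window_average f has_real_derivative 2 * (f (2 * x) - f (2 * x - 1))) (at x)"
proof -
  have "((\<lambda>x. antideriv f (2 * x) - antideriv f (2 * x - 1)) has_real_derivative
    f (2 * x) * 2 - f (2 * x - 1) * 2) (at x)"
    by (intro DERIV_diff DERIV_chain2[OF antideriv[OF assms]]) (auto intro!: derivative_eq_intros)
  thus ?thesis by (simp add: window_average_def[abs_def] algebra_simps)
qed

lemma window_average_symmetric_cdf:
  assumes cont: "continuous_on UNIV f" and f: "symmetric_cdf f"
  shows "symmetric_cdf (window_average f)"
  unfolding symmetric_cdf_def
proof (intro conjI allI impI)
  note A = antideriv[OF cont]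
  show "mono (window_average f)"
  proof (rule monoI)
    fix x y :: real assume "x \<le> y"
    thus "window_average f x \<le> window_average f y"
    proof (rule DERIV_nonneg_imp_nondecreasing)
      fix t
      have "2 * (f (2 * t) - f (2 * t - 1)) \<ge> 0" by (simp add: symmetric_cdf_simps(6)[OF f])
      thus "\<exists>d. (window_average f has_real_derivative d) (at t) \<and> d \<ge> 0"
        using window_average_deriv[OF cont] by blast
    qed
  qed
  show "window_average f x = 0" if "x \<le> 0" for x
  proof -
    have "antideriv f t = antideriv f 0" if "t \<le> 0" for t
      using that by (intro has_real_derivative_zero_ray[OF A] symmetric_cdf_simps[OF f])
    from this[of "2 * x"] this[of "2 * x - 1"] show ?thesis
      using that by (simp add: window_average_def)
  qed
  show "window_average f x + window_average f (1 - x) = 1" for x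
  proof -
    \<comment> \<open>The symmetry f t + f (1 - t) = 1 makes this function constant; comparing it at
      2x and 2x - 1 gives the symmetry of the average.\<close>
    have "((\<lambda>t. antideriv f t - antideriv f (1 - t) - t) has_real_derivative
      f t - f (1 - t) * (- 1) - 1) (at t)" for t
      by (intro DERIV_diff DERIV_chain2[OF A] A) (auto intro!: derivative_eq_intros)
    hence "((\<lambda>t. antideriv f t - antideriv f (1 - t) - t) has_real_derivative 0) (at t)" for t
      by (simp add: symmetric_cdf_simps[OF f])
    hence "antideriv f (2 * x) - antideriv f (1 - 2 * x) - 2 * x =
        antideriv f (2 * x - 1) - antideriv f (1 - (2 * x - 1)) - (2 * x - 1)"
      by (intro DERIV_isconst_all) auto
    thus ?thesis by (simp add: window_average_def algebra_simps)
  qed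
qed

text \<open>The factor 1/2 comes from symmetry: the antiderivative H of f - g is constant outside
  the unit interval and takes the same value at both ends, so each point is within 1/2
  of a place where H has that value.\<close>

lemma window_average_contraction:
  assumes cont: "continuous_on UNIV f" "continuous_on UNIV g"
    and cdf: "symmetric_cdf f" "symmetric_cdf g"
    and M: "\<And>x. \<bar>f x - g x\<bar> \<le> M"
  shows "\<bar>window_average f x - window_average g x\<bar> \<le> M / 2"
proof -
  define H where "H t = antideriv f t - antideriv g t" for t
  have H: "(H has_real_derivative f t - g t) (at t)" for t
    unfolding H_def[abs_def] by (intro DERIV_diff antideriv cont)
  have H0: "H t = H 0" if "t \<le> 0" for t
    using that by (intro has_real_derivative_zero_ray[OF H])
      (simp_all add: symmetric_cdf_simps(1)[OF cdf(1)] symmetric_cdf_simps(1)[OF cdf(2)])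
  have "((\<lambda>t. H t - H (1 - t)) has_real_derivative 0) (at t)" for t
  proof -
    have "((\<lambda>t. H t - H (1 - t)) has_real_derivative (f t - g t) - (f (1 - t) - g (1 - t)) * (-1)) (at t)"
      by (intro DERIV_diff DERIV_chain2[OF H] H) (auto intro!: derivative_eq_intros)
    thus ?thesis by (simp add: symmetric_cdf_simps(3)[OF cdf(1)] symmetric_cdf_simps(3)[OF cdf(2)])
  qed
  hence "H t - H (1 - t) = H (1/2) - H (1 - 1/2)" for t
    by (intro DERIV_isconst_all) auto
  hence sym: "H (1 - t) = H t" for t by simp
  have H1: "H t = H 0" if "t \<ge> 1" for t
    using H0[of "1 - t"] sym[of t] that by simp
  have "M \<ge> 0" using M[of 0] by simp
  have lip: "\<bar>H a - H b\<bar> \<le> M * \<bar>a - b\<bar>" for a b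
    by (rule abs_diff_le_of_deriv_bound[OF H M])
  have close: "\<bar>H t - H 0\<bar> \<le> M / 2" for t
  proof -
    consider "t \<le> 0" | "t \<ge> 1" | "0 \<le> t" "t \<le> 1/2" | "1/2 \<le> t" "t \<le> 1" by linarith
    thus ?thesis
    proof cases
      case 1
      thus ?thesis using H0[of t] \<open>M \<ge> 0\<close> by simp
    next
      case 2
      thus ?thesis using H1[of t] \<open>M \<ge> 0\<close> by simp
    next
      case 3
      hence "M * \<bar>t\<bar> \<le> M * (1/2)" using \<open>M \<ge> 0\<close> by (intro mult_left_mono) auto
      thus ?thesis using lip[of t 0] by simp
    next
      case 4
      hence "M * \<bar>t - 1\<bar> \<le> M * (1/2)" using \<open>M \<ge> 0\<close> by (intro mult_left_mono) auto
      thus ?thesis using lip[of t 1] H1[of 1] by simp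
    qed
  qed
  have "window_average f x - window_average g x = H (2 * x) - H (2 * x - 1)"
    by (simp add: window_average_def H_def)
  \<comment> \<open>The window has length 1, so one of its ends lies outside (0, 1), where H equals
    \<open>H 0\<close>; the other end is within M / 2 of that value.\<close>
  thus ?thesis using close[of "2 * x"] close[of "2 * x - 1"] H0[of "2 * x - 1"] H1[of "2 * x"]
    by (cases "2 * x \<le> 1") (simp_all add: abs_minus_commute)
qed

section \<open>The fixed point in the space of bounded continuous functions\<close>

lemma continuous_on_bcontfun_eval:
  "continuous_on UNIV (\<lambda>f :: 'a::topological_space \<Rightarrow>\<^sub>C 'b::metric_space. apply_bcontfun f x)"
  unfolding continuous_on_iff by (meson dist_fun_lt_imp_dist_val_lt)

text \<open>Every clause compares values at fixed points, and these depend continuously on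
  f.\<close>

lemma closed_symmetric_cdf: "closed {f :: real \<Rightarrow>\<^sub>C real. symmetric_cdf f}"
  unfolding symmetric_cdf_def mono_def
  by (intro closed_Collect_conj closed_Collect_all closed_Collect_imp closed_Collect_le
      closed_Collect_eq open_Collect_const continuous_on_add continuous_on_const
      continuous_on_bcontfun_eval)

text \<open>The uniform distribution on [0, 1] shows that the domain of the contraction is
  nonempty.\<close>

lemma symmetric_cdf_clamp: "symmetric_cdf (\<lambda>x. max 0 (min 1 x))"
  by (auto simp: symmetric_cdf_def mono_def max_def min_def)

lemma symmetric_cdf_bcontfun:
  assumes "continuous_on UNIV f" "symmetric_cdf f"
  shows "apply_bcontfun (Bcontfun f) = f"
  using assms by (intro Bcontfun_inverse bcontfun_normI[where b = 1])
    (simp_all add: symmetric_cdf_simps(4,5)[OF assms(2)])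

text \<open>The fixed point is the distribution function of the sum of U_i / 2^i over i \<ge> 1,
  with independent U_i uniform on [0, 1].\<close>

lemma window_average_fixpoint:
  obtains f where "symmetric_cdf f" "continuous_on UNIV f" "window_average f = f"
proof -
  let ?S = "{f :: real \<Rightarrow>\<^sub>C real. symmetric_cdf f}"
  let ?T = "\<lambda>f :: real \<Rightarrow>\<^sub>C real. Bcontfun (window_average f)"
  have T: "apply_bcontfun (?T f) = window_average f" if "f \<in> ?S" for f
    using that
    by (intro symmetric_cdf_bcontfun continuous_at_imp_continuous_on ballI
        DERIV_isCont[OF window_average_deriv[OF continuous_on_apply_bcontfun]]
        window_average_symmetric_cdf continuous_on_apply_bcontfun) auto
  have "\<exists>!f\<in>?S. ?T f = f"
  proof (rule Banach_fix[where c = "1/2"])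
    show "complete ?S" using closed_symmetric_cdf by (simp add: complete_eq_closed)
    have "Bcontfun (\<lambda>x. max 0 (min 1 x)) \<in> ?S"
      by (subst mem_Collect_eq, subst symmetric_cdf_bcontfun)
        (simp_all add: continuous_on_max continuous_on_min symmetric_cdf_clamp)
    thus "?S \<noteq> {}" by blast
    show "?T ` ?S \<subseteq> ?S"
      using T window_average_symmetric_cdf by auto
    show "dist (?T f) (?T g) \<le> 1/2 * dist f g" if "f \<in> ?S" "g \<in> ?S" for f g
    proof (rule dist_bound)
      fix x
      have "\<bar>window_average f x - window_average g x\<bar> \<le> dist f g / 2"
        using that dist_bounded[of f _ g]
        by (intro window_average_contraction) (auto simp: dist_real_def)
      thus "dist (?T f x) (?T g x) \<le> 1/2 * dist f g"
        using that by (simp add: T dist_real_def)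
    qed
  qed auto
  then obtain f where "f \<in> ?S" "?T f = f" by blast
  with T[of f] that[of f] show ?thesis by auto
qed

section \<open>Smoothness, positivity and support\<close>

lemma smooth_of_rvachev_equation:
  fixes u :: "real \<Rightarrow> real"
  assumes u: "\<And>x. (u has_real_derivative 2 * (u (2 * x + 1) - u (2 * x - 1))) (at x)"
  shows "(deriv ^^ k) u differentiable (at x)"
proof -
  define c :: "nat \<Rightarrow> real" where "c k = 2 ^ Suc k" for k
  \<comment> \<open>Each derivative satisfies the same equation with the factor doubled, so the
    induction carries an explicit next derivative.\<close>
  have "((deriv ^^ k) u has_real_derivative
    c k * ((deriv ^^ k) u (2 * x + 1) - (deriv ^^ k) u (2 * x - 1))) (at x)" for x
  proof (induction k arbitrary: x)
    case 0
    show ?case using u[of x] by (simp add: c_def)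
  next
    case (Suc k)
    let ?v = "(deriv ^^ k) u"
    have v': "(deriv ^^ Suc k) u = (\<lambda>x. c k * (?v (2 * x + 1) - ?v (2 * x - 1)))"
      using DERIV_imp_deriv[OF Suc.IH] by auto
    have "((\<lambda>x. c k * (?v (2 * x + 1) - ?v (2 * x - 1))) has_real_derivative
       c k * ((deriv ^^ Suc k) u (2 * x + 1) * 2 - (deriv ^^ Suc k) u (2 * x - 1) * 2)) (at x)"
      unfolding v' by (intro DERIV_cmult DERIV_diff DERIV_chain2[OF Suc.IH])
        (auto intro!: derivative_eq_intros)
    thus ?case unfolding v'[symmetric] by (simp add: c_def algebra_simps)
  qed
  thus ?thesis using real_differentiable_def by blast
qed

lemma is_rvachev_exists: "\<exists>u. is_rvachev u"
proof -
  obtain f where cdf: "symmetric_cdf f" and cont: "continuous_on UNIV f"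
    and fixpoint: "window_average f = f" by (rule window_average_fixpoint)
  note outside = symmetric_cdf_simps(1,2)[OF cdf] and reflect = symmetric_cdf_simps(3)[OF cdf]
    and nonneg = symmetric_cdf_simps(4)[OF cdf]
  have f: "(f has_real_derivative 2 * (f (2 * x) - f (2 * x - 1))) (at x)" for x
    using window_average_deriv[OF cont, of x] unfolding fixpoint .
  have half: "f (1/2) = 1/2" using reflect[of "1/2"] by simp
  \<comment> \<open>A zero x in the left half is a minimum, hence a critical point, so 2x is a zero as well.\<close>
  have double: "f (2 * x) = 0" if "f x = 0" "x \<le> 1/2" for x
  proof -
    have "2 * (f (2 * x) - f (2 * x - 1)) = 0"
      using that by (intro DERIV_local_min[where d = 1, OF f]) (simp_all add: nonneg)
    thus ?thesis using that outside(1)[of "2 * x - 1"] by simp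
  qed
  have pos: "f x > 0" if "x > 0" for x
  proof (rule ccontr)
    assume "\<not> f x > 0"
    hence fx: "f x = 0" using nonneg[of x] by simp
    \<comment> \<open>As f (1/2) = 1/2 and f is monotone, every zero lies left of 1/2, so
      \<open>double\<close> applies again and again until the orbit passes 1, where f is 1.\<close>
    have orbit: "f (2 ^ n * x) = 0" for n
    proof (induction n)
      case (Suc n)
      hence "\<not> 2 ^ n * x \<ge> 1/2"
        using symmetric_cdf_simps(6)[OF cdf, of "1/2" "2 ^ n * x"] half by auto
      thus ?case using double[OF Suc.IH] by (simp add: mult_ac)
    qed (use fx in simp)
    obtain n where "1 / x < 2 ^ n" using real_arch_pow[of 2 "1 / x"] by auto
    hence "2 ^ n * x \<ge> 1" using \<open>x > 0\<close> by (simp add: field_simps)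
    thus False using outside(2)[of "2 ^ n * x"] orbit[of n] by simp
  qed
  \<comment> \<open>By the equation for f this is half of f' at (x + 1) / 2: the density of f,
    recentred from [0, 1] to [-1, 1].\<close>
  define u where "u x = f (x + 1) - f x" for x
  have u: "(u has_real_derivative 2 * (u (2 * x + 1) - u (2 * x - 1))) (at x)" for x
  proof -
    have "(u has_real_derivative 2 * (f (2 * (x + 1)) - f (2 * (x + 1) - 1)) * 1
      - 2 * (f (2 * x) - f (2 * x - 1))) (at x)"
      unfolding u_def[abs_def]
      by (intro DERIV_diff f DERIV_chain2[OF f]) (auto intro!: derivative_eq_intros)
    thus ?thesis by (simp add: u_def algebra_simps)
  qed
  have "u x \<noteq> 0 \<longleftrightarrow> -1 < x \<and> x < 1" for x
  proof -
    consider "x \<le> -1" | "x \<ge> 1" | "-1 < x" "x \<le> 0" | "0 < x" "x < 1" by linarith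
    thus ?thesis
    proof cases
      case 3
      thus ?thesis using pos[of "x + 1"] outside(1)[of x] by (simp add: u_def)
    next
      case 4
      \<comment> \<open>Here f (x + 1) = 1, and 1 - f x = f (1 - x) > 0 by symmetry.\<close>
      thus ?thesis using pos[of "1 - x"] reflect[of x] outside(2)[of "x + 1"] by (simp add: u_def)
    qed (simp_all add: u_def outside)
  qed
  hence "{x. u x \<noteq> 0} = {-1<..<1}" by (simp add: set_eq_iff)
  hence "closure {x. u x \<noteq> 0} = {-1..1}" by simp
  moreover have "u 0 = 1" using outside(1)[of 0] outside(2)[of 1] by (simp add: u_def)
  ultimately show ?thesis
    using u smooth_of_rvachev_equation[OF u] unfolding is_rvachev_def by blast
qed

section \<open>The Fabius function\<close>

text \<open>Digit sums of different numbers can be compared only over a common range of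
  positions.\<close>

lemma binary_digit_sum_eq:
  assumes "n \<le> N"
  shows "binary_digit_sum n = (\<Sum>k<N. n div 2 ^ k mod 2)"
proof -
  have "n div 2 ^ k = 0" if "k \<ge> n" for k
  proof -
    have "n < 2 ^ n" by simp
    also have "(2 :: nat) ^ n \<le> 2 ^ k" using that by (intro power_increasing) auto
    finally show ?thesis by simp
  qed
  thus ?thesis
    unfolding binary_digit_sum_def using assms by (intro sum.mono_neutral_left) auto
qed

lemma binary_digit_sum_div_2: "binary_digit_sum n = n mod 2 + binary_digit_sum (n div 2)"
proof -
  have "binary_digit_sum n = (\<Sum>k<Suc n. n div 2 ^ k mod 2)"
    by (intro binary_digit_sum_eq) simp
  also have "\<dots> = n mod 2 + (\<Sum>k<n. n div 2 div 2 ^ k mod 2)"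
    by (subst sum.lessThan_Suc_shift) (simp add: div_mult2_eq)
  also have "(\<Sum>k<n. n div 2 div 2 ^ k mod 2) = binary_digit_sum (n div 2)"
    by (intro binary_digit_sum_eq[symmetric]) simp
  finally show ?thesis .
qed

text \<open>The new digit 1 sits above all digits of i; the induction strips the lowest
  digit.\<close>

lemma binary_digit_sum_add_power_2:
  "i < 2 ^ k \<Longrightarrow> binary_digit_sum (i + 2 ^ k) = Suc (binary_digit_sum i)"
proof (induction k arbitrary: i)
  case 0
  thus ?case by (simp add: binary_digit_sum_def)
next
  case (Suc k)
  have "(i + 2 ^ Suc k) mod 2 = i mod 2" "(i + 2 ^ Suc k) div 2 = i div 2 + 2 ^ k" by simp_all
  moreover have "binary_digit_sum (i div 2 + 2 ^ k) = Suc (binary_digit_sum (i div 2))"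
    using Suc.prems by (intro Suc.IH) auto
  ultimately show ?case
    by (subst (1 2) binary_digit_sum_div_2) (simp add: add.commute)
qed

section \<open>The two shift formulas for the Fabius function\<close>

lemma is_rvachev_up: "is_rvachev rvachev_up"
  unfolding rvachev_up_def
  using is_rvachev_exists is_rvachev_unique by (metis theI)

text \<open>The supports of the translates meet only at endpoints, where all translates vanish;
  hence the closed interval.\<close>

lemma fabius_eq_rvachev_up:
  assumes "2 * real j \<le> x" "x \<le> 2 * real j + 2"
  shows "fabius x = (-1) ^ binary_digit_sum j * rvachev_up (x - 2 * real j - 1)"
proof -
  have "rvachev_up (x - 2 * real i - 1) = 0" if "i \<noteq> j" for i
  proof -
    have "real i + 1 \<le> real j \<or> real j + 1 \<le> real i" using that by linarith
    thus ?thesis using assms by (intro is_rvachev_vanish[OF is_rvachev_up]) auto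
  qed
  thus ?thesis
    unfolding fabius_def by (subst suminf_finite[of "{j}"]) auto
qed

text \<open>The shift moves the index j of the active translate to j + 2^k, which adds one binary
  digit 1 and so flips the sign.\<close>

lemma fabius_shift_power_2:
  assumes "0 \<le> y" "y < 2 ^ Suc k"
  shows "fabius (2 ^ Suc k + y) = - fabius y"
proof -
  define j where "j = nat \<lfloor>y / 2\<rfloor>"
  have "real j = of_int \<lfloor>y / 2\<rfloor>" using assms by (simp add: j_def)
  hence j: "2 * real j \<le> y" "y \<le> 2 * real j + 2" by linarith+
  have "real j < 2 ^ k" using j assms unfolding power_Suc by linarith
  hence "j < 2 ^ k" by simp
  hence "binary_digit_sum (j + 2 ^ k) = Suc (binary_digit_sum j)"
    by (rule binary_digit_sum_add_power_2)
  moreover have "fabius (2 ^ Suc k + y) = (-1) ^ binary_digit_sum (j + 2 ^ k) *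
      rvachev_up (2 ^ Suc k + y - 2 * real (j + 2 ^ k) - 1)"
    using j by (intro fabius_eq_rvachev_up) auto
  moreover have "2 ^ Suc k + y - 2 * real (j + 2 ^ k) - 1 = y - 2 * real j - 1" by simp
  ultimately show ?thesis using fabius_eq_rvachev_up[OF j] by simp
qed

lemma fabius_shift_inverse_power_2:
  assumes "0 \<le> y" "y \<le> 1 / 2 ^ n"
  shows "fabius (1 / 2 ^ n + y) + fabius y =
    (\<Sum>k\<le>n. 2 ^ (Suc k choose 2) / 2 ^ ((n - k) choose 2) *
       (of_rat (fabius_d (n - k)) / fact (n - k)) * (y ^ k / fact k))"
proof -
  \<comment> \<open>On [0, 2] this is \<open>fabius\<close>; its value at 1 is up(0) = 1, which
    removes the factor \<open>F 1\<close>.\<close>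
  let ?F = "\<lambda>x. rvachev_up (x - 1) - rvachev_up (x - 3)"
  note vanish = is_rvachev_vanish[OF is_rvachev_up]
  interpret fabius_equation ?F
    by (rule fabius_equation_of_rvachev_equation[OF vanish])
      (use is_rvachev_up in \<open>auto simp: is_rvachev_def\<close>)
  have F: "fabius x = ?F x" if "0 \<le> x" "x \<le> 2" for x
    using fabius_eq_rvachev_up[of 0 x] that vanish[of "x - 3"] by (simp add: binary_digit_sum_def)
  have "?F 1 = 1"
    using vanish[of "-2"] is_rvachev_up by (simp add: is_rvachev_def)
  moreover have "1 / 2 ^ n \<le> (1 :: real)" by simp
  hence "1 / 2 ^ n + y \<le> 2" "y \<le> 2" using assms by linarith+
  ultimately show ?thesis
    using shift_eq_polynomial[OF assms] assms F[of "1 / 2 ^ n + y"] F[of y] by simp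
qed

theorem proposition10:
  fixes x y :: real and n :: int
  assumes "x > 0"
    and "2 powi (-n) \<le> x" and "x < 2 powi (-n + 1)"
    and "y = x - 2 powi (-n)"
  shows "fabius x = - fabius y +
    (\<Sum>k\<in>{0..n}. 2 powi (int (nat (k + 1) choose 2) - int (nat (n - k) choose 2)) *
       (of_rat (fabius_d (nat (n - k))) / fact (nat (n - k))) * (y ^ nat k / fact (nat k)))"
proof (cases "n \<ge> 0")
  case True
  then obtain m where n: "n = int m" using nonneg_int_cases by blast
  have "2 powi (-n) = (1 / 2 ^ m :: real)" "2 powi (-n + 1) = (2 / 2 ^ m :: real)"
    by (simp_all add: n power_int_add power_int_diff power_int_minus field_simps)
  hence y: "0 \<le> y" "y \<le> 1 / 2 ^ m" "x = 1 / 2 ^ m + y"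
    using assms by simp_all
  have "(\<Sum>k\<in>{0..n}. 2 powi (int (nat (k + 1) choose 2) - int (nat (n - k) choose 2)) *
       (of_rat (fabius_d (nat (n - k))) / fact (nat (n - k))) * (y ^ nat k / fact (nat k))) =
    (\<Sum>k\<le>m. 2 ^ (Suc k choose 2) / 2 ^ ((m - k) choose 2) *
       (of_rat (fabius_d (m - k)) / fact (m - k)) * (y ^ k / fact k))"
    by (rule sum.reindex_bij_witness[of _ int nat])
      (auto simp: n power_int_diff nat_add_distrib nat_diff_distrib' simp del: binomial_Suc_Suc)
  thus ?thesis using fabius_shift_inverse_power_2[OF y(1,2)] y(3) by simp
next
  case False
  \<comment> \<open>With n = -(k + 1) the shift is \<open>2 ^ Suc k\<close>, an even integer, and
    the range of summation is empty.\<close>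
  then obtain k where n: "n = - int (Suc k)"
    by (metis not_le neg_int_cases gr0_conv_Suc)
  hence "2 powi (-n) = (2 ^ Suc k :: real)"
    by (simp only: minus_minus power_int_of_nat)
  moreover from this have "2 powi (-n + 1) = (2 * 2 ^ Suc k :: real)"
    by (subst power_int_add) simp_all
  ultimately have "0 \<le> y" "y < 2 ^ Suc k" "x = 2 ^ Suc k + y"
    using assms by simp_all
  thus ?thesis using fabius_shift_power_2[of y k] False by simp
qed

end
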